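(* Let $Z_1,\dots,Z_n,Z_{n+1}=(X_{n+1},Y_{n+1})$ be an exchangeable sequence of random variables in $\mathbb{R}^{p+1}$ and let $\tau\sim\mathrm{Unif}[0,1]$ be independent of it. Suppose the split conformity measure $E$ is monotonic and balanced and that the conformal atoms are almost surely distinct. Let $\tilde Q^{CPD}$ be the tail-corrected conformal predictive distribution defined in the context, and let $\widehat Q^{CPD}(\cdot,(X_{n+1},y),\tau)$ be an approximation of $\tilde Q^{CPD}(\cdot,(X_{n+1},y),\tau)$ that is continuous in $y$. Suppose that for some $\varepsilon>0$ and any $y\in\mathbb{R}$, $$\left|\widehat Q^{CPD}(\cdot,(X_{n+1},y),\tau)-\tilde Q^{CPD}(\cdot,(X_{n+1},y),\tau)\right|\le\varepsilon\quad\text{almost surely.}$$ Then $$\sup_{u\in[0,1]}\left|\mathbb{P}\bigl(\widehat Q^{CPD}(\cdot,(X_{n+1},Y_{n+1}),\tau)\le u\bigr)-u\right|\le\varepsilon+\frac{1}{n-m+1}.$$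
   Context: Write $z_i=(x_i,y_i)\in\mathbb{R}^p\times\mathbb{R}$. The first $m<n$ observations $z_1,\dots,z_m$ form the training set and $z_{m+1},\dots,z_n$ the calibration set. It is assumed that $n-m\ge 2$. A split conformity measure is a measurable function $E:(\mathbb{R}^{p+1})^{m+1}\to\mathbb{R}$. It is monotonic if $y\le y'$ implies $E(z_1,\dots,z_m,(x,y))\le E(z_1,\dots,z_m,(x,y'))$ for all $x$. A monotonic $E$ is balanced if for all $z_1,\dots,z_m$ the convex hull of $\{E(z_1,\dots,z_m,(x,y)):y\in\mathbb{R}\}$ is an open interval of $\mathbb{R}$ not depending on $x$. Standing assumption (coercivity): the convex hull of $E(z_1,\dots,z_m,\mathbb{R}^{p+1})$ is $(-\infty,\infty)$. Conformal atoms: for $i=1,\dots,n-m$, $C_i=C_i(x_{n+1})$ is the solution of $E(z_1,\dots,z_m,(x_{m+i},y_{m+i}))=E(z_1,\dots,z_m,(x_{n+1},C_i))$ (assumed to exist); $C_{(1)}\le\dots\le C_{(n-m)}$ are the sorted atoms. Measure of the split conformal predictive system, on $[-\infty,\infty]$: $$\mu_n(\cdot\mid x_{n+1})=\frac{\tau}{n-m+1}\delta_{-\infty}+\sum_{i=1}^{n-m}\frac{1}{n-m+1}\delta_{C_{(i)}(x_{n+1})}+\frac{1-\tau}{n-m+1}\delta_{+\infty}.$$ Tail-corrected measure, on $\mathbb{R}$: $$\tilde\mu_n(\cdot\mid x_{n+1})=\frac{1+\tau}{n-m+1}\delta_{C_{(1)}(x_{n+1})}+\sum_{i=2}^{n-m-1}\frac{1}{n-m+1}\delta_{C_{(i)}(x_{n+1})}+\frac{2-\tau}{n-m+1}\delta_{C_{(n-m)}(x_{n+1})}.$$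 The associated randomized predictive distributions are $$Q^{CPD}(\cdot,(x_{n+1},y),\tau)=\mu_n([-\infty,y)\mid x_{n+1})+\tau\mu_n(\{y\}\mid x_{n+1}),$$ $$\tilde Q^{CPD}(\cdot,(x_{n+1},y),\tau)=\tilde\mu_n((-\infty,y)\mid x_{n+1})+\tau\tilde\mu_n(\{y\}\mid x_{n+1}),$$ where the dot stands for $z_1,\dots,z_n$ (random: $Z_1,\dots,Z_n$). The approximation $\widehat Q^{CPD}$ is a measurable function of the same arguments. It is part of the setting that $Q^{CPD}$ coincides with the split conformal transducer determined by $E$, namely $$\frac{|\{i:E_i<E^y\}|+\tau|\{i:E_i=E^y\}|+\tau}{n-m+1},$$ with $i=1,\dots,n-m$, $E_i=E(z_1,\dots,z_m,(x_{m+i},y_{m+i}))$ and $E^y=E(z_1,\dots,z_m,(x_{n+1},y))$. Known fact: for exchangeable $Z_1,\dots,Z_{n+1}$ and independent $\tau\sim\mathrm{Unif}[0,1]$, a split conformal transducer evaluated at $(Z_1,\dots,Z_{n+1},\tau)$ is $\mathrm{Unif}[0,1]$. *)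

theory Defs
  imports "HOL-Probability.Probability" "HOL-Combinatorics.Permutations"
begin

type_synonym 'p example = "(real ^ 'p) \<times> real"

text \<open>
  A function on \<open>(\<real>\<^sup>p\<^sup>+\<^sup>1)\<^sup>m\<^sup>+\<^sup>1\<close> is curried: the first argument is the training
  sequence, an extensional function on \<open>{1..m}\<close>; the second argument is the last coordinate.
\<close>

type_synonym 'p conformity = "(nat \<Rightarrow> 'p example) \<Rightarrow> 'p example \<Rightarrow> real"

definition split_conformity_measure :: "nat \<Rightarrow> ('p::finite) conformity \<Rightarrow> bool" where
  "split_conformity_measure m E \<longleftrightarrow>
     (\<lambda>(z, w). E z w) \<in> borel_measurable ((\<Pi>\<^sub>M i\<in>{1..m}. borel) \<Otimes>\<^sub>M borel)"

definition monotonic :: "nat \<Rightarrow> ('p::finite) conformity \<Rightarrow> bool" where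
  "monotonic m E \<longleftrightarrow>
     (\<forall>z\<in>{1..m} \<rightarrow>\<^sub>E UNIV. \<forall>x y y'. y \<le> y' \<longrightarrow> E z (x, y) \<le> E z (x, y'))"

definition balanced :: "nat \<Rightarrow> ('p::finite) conformity \<Rightarrow> bool" where
  "balanced m E \<longleftrightarrow>
     (\<forall>z\<in>{1..m} \<rightarrow>\<^sub>E UNIV. \<exists>I. open I \<and> is_interval I \<and>
        (\<forall>x. convex hull (range (\<lambda>y. E z (x, y))) = I))"

definition coercive :: "nat \<Rightarrow> ('p::finite) conformity \<Rightarrow> bool" where
  "coercive m E \<longleftrightarrow> (\<forall>z\<in>{1..m} \<rightarrow>\<^sub>E UNIV. convex hull (range (E z)) = UNIV)"

text \<open>
  Below, \<open>z\<close> is the data sequence, of which only the values at \<open>1, \<dots>, n\<close> matter.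
  The equation defining the conformal atoms need not be solvable for arbitrary \<open>E\<close>;
  \<open>conformal_atoms_exist\<close> says that each atom is well defined.
\<close>

definition is_conformal_atom ::
  "nat \<Rightarrow> ('p::finite) conformity \<Rightarrow> (nat \<Rightarrow> 'p example) \<Rightarrow> real ^ 'p \<Rightarrow> nat \<Rightarrow> real \<Rightarrow> bool" where
  "is_conformal_atom m E z x i c \<longleftrightarrow>
     E (restrict z {1..m}) (z (m + i)) = E (restrict z {1..m}) (x, c)"

definition conformal_atoms_exist ::
  "nat \<Rightarrow> nat \<Rightarrow> ('p::finite) conformity \<Rightarrow> (nat \<Rightarrow> 'p example) \<Rightarrow> real ^ 'p \<Rightarrow> bool" where
  "conformal_atoms_exist m n E z x \<longleftrightarrow> (\<forall>i\<in>{1..n - m}. \<exists>!c. is_conformal_atom m E z x i c)"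

definition conformal_atom ::
  "nat \<Rightarrow> ('p::finite) conformity \<Rightarrow> (nat \<Rightarrow> 'p example) \<Rightarrow> real ^ 'p \<Rightarrow> nat \<Rightarrow> real" where
  "conformal_atom m E z x i = (THE c. is_conformal_atom m E z x i c)"

definition sorted_atom ::
  "nat \<Rightarrow> nat \<Rightarrow> ('p::finite) conformity \<Rightarrow> (nat \<Rightarrow> 'p example) \<Rightarrow> real ^ 'p \<Rightarrow> nat \<Rightarrow> real" where
  "sorted_atom m n E z x i = sort (map (conformal_atom m E z x) [1..<n - m + 1]) ! (i - 1)"

text \<open>
  The two measures are finite sums of weighted Dirac measures, given by their values on Borel
  sets: \<open>indicator A c\<close> is the Dirac mass at \<open>c\<close> of the set \<open>A\<close>.
\<close>

definition cpd_measure ::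
  "nat \<Rightarrow> nat \<Rightarrow> ('p::finite) conformity \<Rightarrow> (nat \<Rightarrow> 'p example) \<Rightarrow> real ^ 'p \<Rightarrow> real \<Rightarrow> ereal measure" where
  "cpd_measure m n E z x \<tau> = measure_of UNIV (sets borel) (\<lambda>A.
       ennreal (\<tau> / real (n - m + 1)) * indicator A (- \<infinity>)
     + (\<Sum>i = 1..n - m. ennreal (1 / real (n - m + 1)) * indicator A (ereal (sorted_atom m n E z x i)))
     + ennreal ((1 - \<tau>) / real (n - m + 1)) * indicator A \<infinity>)"

definition tail_corrected_measure ::
  "nat \<Rightarrow> nat \<Rightarrow> ('p::finite) conformity \<Rightarrow> (nat \<Rightarrow> 'p example) \<Rightarrow> real ^ 'p \<Rightarrow> real \<Rightarrow> real measure" where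
  "tail_corrected_measure m n E z x \<tau> = measure_of UNIV (sets borel) (\<lambda>A.
       ennreal ((1 + \<tau>) / real (n - m + 1)) * indicator A (sorted_atom m n E z x 1)
     + (\<Sum>i = 2..n - m - 1. ennreal (1 / real (n - m + 1)) * indicator A (sorted_atom m n E z x i))
     + ennreal ((2 - \<tau>) / real (n - m + 1)) * indicator A (sorted_atom m n E z x (n - m)))"

definition cpd ::
  "nat \<Rightarrow> nat \<Rightarrow> ('p::finite) conformity \<Rightarrow> (nat \<Rightarrow> 'p example) \<Rightarrow> 'p example \<Rightarrow> real \<Rightarrow> real" where
  "cpd m n E z = (\<lambda>(x, y) \<tau>.
       measure (cpd_measure m n E z x \<tau>) {..<ereal y}
     + \<tau> * measure (cpd_measure m n E z x \<tau>) {ereal y})"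

definition tail_corrected_cpd ::
  "nat \<Rightarrow> nat \<Rightarrow> ('p::finite) conformity \<Rightarrow> (nat \<Rightarrow> 'p example) \<Rightarrow> 'p example \<Rightarrow> real \<Rightarrow> real" where
  "tail_corrected_cpd m n E z = (\<lambda>(x, y) \<tau>.
       measure (tail_corrected_measure m n E z x \<tau>) {..<y}
     + \<tau> * measure (tail_corrected_measure m n E z x \<tau>) {y})"

definition split_transducer ::
  "nat \<Rightarrow> nat \<Rightarrow> ('p::finite) conformity \<Rightarrow> (nat \<Rightarrow> 'p example) \<Rightarrow> 'p example \<Rightarrow> real \<Rightarrow> real" where
  "split_transducer m n E z w \<tau> =
     (let z' = restrict z {1..m} in
       (real (card {i\<in>{1..n - m}. E z' (z (m + i)) < E z' w})
        + \<tau> * real (card {i\<in>{1..n - m}. E z' (z (m + i)) = E z' w}) + \<tau>) / real (n - m + 1))"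

definition exchangeable ::
  "'a measure \<Rightarrow> 'i set \<Rightarrow> 'b measure \<Rightarrow> ('i \<Rightarrow> 'a \<Rightarrow> 'b) \<Rightarrow> bool" where
  "exchangeable M I N X \<longleftrightarrow> (\<forall>\<pi>. \<pi> permutes I \<longrightarrow>
     distr M (\<Pi>\<^sub>M i\<in>I. N) (\<lambda>\<omega>. \<lambda>i\<in>I. X (\<pi> i) \<omega>) = distr M (\<Pi>\<^sub>M i\<in>I. N) (\<lambda>\<omega>. \<lambda>i\<in>I. X i \<omega>))"

text \<open>
  The library's \<open>indep_var\<close> requires the two random variables to have the same value type,
  so independence is stated for the generated \<open>\<sigma>\<close>-algebras.
\<close>

definition indep_rv ::
  "'a measure \<Rightarrow> 'b measure \<Rightarrow> ('a \<Rightarrow> 'b) \<Rightarrow> 'c measure \<Rightarrow> ('a \<Rightarrow> 'c) \<Rightarrow> bool" where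
  "indep_rv M N X N' Y \<longleftrightarrow>
     prob_space.indep_set M {X -` A \<inter> space M | A. A \<in> sets N} {Y -` B \<inter> space M | B. B \<in> sets N'}"

lemma countably_additive_dirac_sum:
  fixes a b :: ennreal and w :: "nat \<Rightarrow> ennreal" and x y :: 'a
  shows "countably_additive S
    (\<lambda>A. a * indicator A x + (\<Sum>i\<in>I. w i * indicator A (f i)) + b * indicator A y)"
proof (unfold countably_additive_def, intro allI impI)
  fix A :: "nat \<Rightarrow> 'a set"
  assume "disjoint_family A"
  then have *: "(\<Sum>k. c * indicator (A k) u) = c * indicator (\<Union>k. A k) u" for c :: ennreal and u
    by (simp add: suminf_indicator)
  show "(\<Sum>k. a * indicator (A k) x + (\<Sum>i\<in>I. w i * indicator (A k) (f i)) + b * indicator (A k) y)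
    = a * indicator (\<Union>k. A k) x + (\<Sum>i\<in>I. w i * indicator (\<Union>k. A k) (f i))
      + b * indicator (\<Union>k. A k) y"
    by (simp only: suminf_add[symmetric] suminf_sum summableI *)
qed

lemma sets_cpd_measure [simp]: "sets (cpd_measure m n E z x \<tau>) = sets borel"
  unfolding cpd_measure_def using sets.sets_measure_of_eq[of "borel :: ereal measure"] by simp

lemma sets_tail_corrected_measure [simp]: "sets (tail_corrected_measure m n E z x \<tau>) = sets borel"
  unfolding tail_corrected_measure_def
  using sets.sets_measure_of_eq[of "borel :: real measure"] by simp

lemma emeasure_cpd_measure:
  assumes "A \<in> sets borel"
  shows "emeasure (cpd_measure m n E z x \<tau>) A =
       ennreal (\<tau> / real (n - m + 1)) * indicator A (- \<infinity>)
     + (\<Sum>i = 1..n - m. ennreal (1 / real (n - m + 1)) * indicator A (ereal (sorted_atom m n E z x i)))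
     + ennreal ((1 - \<tau>) / real (n - m + 1)) * indicator A \<infinity>"
  by (rule emeasure_measure_of[OF cpd_measure_def _ _ countably_additive_dirac_sum])
     (use assms in \<open>auto simp: positive_def\<close>)

lemma emeasure_tail_corrected_measure:
  assumes "A \<in> sets borel"
  shows "emeasure (tail_corrected_measure m n E z x \<tau>) A =
       ennreal ((1 + \<tau>) / real (n - m + 1)) * indicator A (sorted_atom m n E z x 1)
     + (\<Sum>i = 2..n - m - 1. ennreal (1 / real (n - m + 1)) * indicator A (sorted_atom m n E z x i))
     + ennreal ((2 - \<tau>) / real (n - m + 1)) * indicator A (sorted_atom m n E z x (n - m))"
  by (rule emeasure_measure_of[OF tail_corrected_measure_def _ _ countably_additive_dirac_sum])
     (use assms in \<open>auto simp: positive_def\<close>)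

lemma sum_sorted_atom:
  fixes g :: "real \<Rightarrow> 'b::comm_monoid_add"
  shows "(\<Sum>i = 1..n - m. g (sorted_atom m n E z x i)) = (\<Sum>i = 1..n - m. g (conformal_atom m E z x i))"
proof -
  let ?N = "n - m"
  let ?xs = "map (conformal_atom m E z x) [1..<?N + 1]"
  have "(\<Sum>i = 1..?N. g (sorted_atom m n E z x i)) = (\<Sum>i<?N. g (sort ?xs ! i))"
    by (rule sum.reindex_bij_witness[of _ Suc "\<lambda>i. i - 1"])
       (auto simp: sorted_atom_def simp del: upt_Suc)
  also have "\<dots> = sum_list (map g (sort ?xs))"
    by (simp add: sum_list_sum_nth lessThan_atLeast0 del: upt_Suc)
  also have "\<dots> = sum_mset (image_mset g (mset (sort ?xs)))"
    by (metis mset_map sum_mset_sum_list)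
  also have "\<dots> = sum_list (map g ?xs)"
    by (metis mset_map mset_sort sum_mset_sum_list)
  also have "\<dots> = (\<Sum>i\<in>{1..<?N + 1}. g (conformal_atom m E z x i))"
    by (simp add: interv_sum_list_conv_sum_set_nat o_def del: upt_Suc)
  also have "{1..<?N + 1} = {1..?N}"
    by auto
  finally show ?thesis .
qed

lemma measure_cpd_measure:
  assumes "A \<in> sets borel" "- \<infinity> \<in> A \<longleftrightarrow> P" "\<infinity> \<notin> A" "0 \<le> \<tau>"
  shows "measure (cpd_measure m n E z x \<tau>) A =
    ((if P then \<tau> else 0) + real (card {i\<in>{1..n - m}. ereal (conformal_atom m E z x i) \<in> A}))
      / real (n - m + 1)"
proof -
  let ?k = "card {i\<in>{1..n - m}. ereal (conformal_atom m E z x i) \<in> A}"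
  have k: "(\<Sum>i = 1..n - m. indicator A (ereal (conformal_atom m E z x i)) :: ennreal) = of_nat ?k"
  proof -
    have "(\<Sum>i = 1..n - m. indicator A (ereal (conformal_atom m E z x i)) :: ennreal)
        = (\<Sum>i = 1..n - m. if ereal (conformal_atom m E z x i) \<in> A then 1 else 0)"
      by (intro sum.cong) (auto simp: indicator_def)
    also have "\<dots> = of_nat ?k"
      by (subst sum.inter_filter[symmetric]) auto
    finally show ?thesis .
  qed
  have "emeasure (cpd_measure m n E z x \<tau>) A
     = ennreal (\<tau> / real (n - m + 1)) * indicator A (- \<infinity>)
     + ennreal (1 / real (n - m + 1)) * of_nat ?k"
    unfolding emeasure_cpd_measure[OF assms(1)] sum_distrib_left[symmetric]
      sum_sorted_atom[where g = "\<lambda>c. indicator A (ereal c)"] k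
    using assms(3) by simp
  also have "\<dots> = ennreal (((if P then \<tau> else 0) + real ?k) / real (n - m + 1))"
    using assms(2,4)
    by (auto simp: ennreal_of_nat_eq_real_of_nat add_divide_distrib
        simp flip: ennreal_mult ennreal_plus)
  finally show ?thesis
    using assms(4) by (simp add: measure_def)
qed

text \<open>
  When the atoms are well defined, the predictive distribution is the transducer determined
  by \<open>E\<close>, so that no separate hypothesis is needed to relate the two.
\<close>

lemma cpd_eq_split_transducer:
  assumes "monotonic m E" "conformal_atoms_exist m n E z x" "0 \<le> \<tau>"
  shows "cpd m n E z (x, y) \<tau> = split_transducer m n E z (x, y) \<tau>"
proof -
  define z' where "z' = restrict z {1..m}"
  let ?C = "conformal_atom m E z x"
  have z': "z' \<in> {1..m} \<rightarrow>\<^sub>E UNIV"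
    by (simp add: z'_def)
  have mono: "a \<le> b \<Longrightarrow> E z' (x, a) \<le> E z' (x, b)" for a b
    using assms(1) z' unfolding monotonic_def by blast
  have uniq: "E z' (z (m + i)) = E z' (x, c) \<longleftrightarrow> c = ?C i" if "i \<in> {1..n - m}" for i c
  proof -
    have "\<exists>!c. is_conformal_atom m E z x i c"
      using assms(2) that unfolding conformal_atoms_exist_def by blast
    then have "is_conformal_atom m E z x i c \<longleftrightarrow> c = ?C i"
      unfolding conformal_atom_def by (metis the1_equality)
    then show ?thesis
      by (simp add: is_conformal_atom_def z'_def)
  qed
  have less: "E z' (z (m + i)) < E z' (x, y) \<longleftrightarrow> ?C i < y" if "i \<in> {1..n - m}" for i
  proof -
    have eq: "E z' (z (m + i)) = E z' (x, ?C i)"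
      using uniq[OF that] by blast
    have "E z' (x, ?C i) \<noteq> E z' (x, y)" if "?C i < y"
      using uniq[OF \<open>i \<in> _\<close>, of y] eq that by auto
    then show ?thesis
      using mono[of "?C i" y] mono[of y "?C i"] unfolding eq by force
  qed
  have 1: "{i\<in>{1..n - m}. ereal (?C i) \<in> {..<ereal y}}
      = {i\<in>{1..n - m}. E z' (z (m + i)) < E z' (x, y)}"
    using less by auto
  have 2: "{i\<in>{1..n - m}. ereal (?C i) \<in> {ereal y}}
      = {i\<in>{1..n - m}. E z' (z (m + i)) = E z' (x, y)}"
    using uniq by auto
  show ?thesis
    using measure_cpd_measure[of "{..<ereal y}" True \<tau> m n E z x]
      measure_cpd_measure[of "{ereal y}" False \<tau> m n E z x] assms(3)
    unfolding 1 2
    by (simp add: cpd_def split_transducer_def z'_def Let_def add_divide_distrib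
        algebra_simps)
qed

end

theory Submission
  imports Defs
begin

text \<open>
  Put \<open>K = n - m + 1\<close>. The transducer is the randomized rank of the last score among the \<open>K\<close>
  scores outside the training set. By exchangeability its law is the average over the \<open>K\<close> positions, and
  for fixed data and uniform \<open>\<tau>\<close> the average of the distribution functions of the \<open>K\<close> ranks telescopes
  to the identity on \<open>[0, 1]\<close>.

  Away from the atoms, the tail correction moves the predictive distribution by at most \<open>1 / K\<close>, so at all
  rational non-atoms the approximation is within \<open>\<epsilon> + 1 / K\<close> of the step function \<open>Q\<^sup>C\<^sup>P\<^sup>D\<close>. Continuity of
  the approximation carries this bound to both one-sided limits of \<open>Q\<^sup>C\<^sup>P\<^sup>D\<close> at every \<open>y\<close>, and \<open>Q\<^sup>C\<^sup>P\<^sup>D\<close> at \<open>y\<close>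
  is a convex combination of them with weights \<open>1 - \<tau>\<close> and \<open>\<tau>\<close>. Hence the bound holds at \<open>Y\<^sub>n\<^sub>+\<^sub>1\<close>,
  where \<open>Q\<^sup>C\<^sup>P\<^sup>D\<close> is uniform.
\<close>

section \<open>Randomized ranks and the average of their distribution functions\<close>

definition smoothed_rank :: "'i set \<Rightarrow> ('i \<Rightarrow> real) \<Rightarrow> 'i \<Rightarrow> real \<Rightarrow> real" where
  "smoothed_rank J s j t =
     (real (card {i\<in>J. s i < s j}) + t * real (card {i\<in>J. s i = s j})) / real (card J)"

text \<open>The number of indices at or below one value of \<open>s\<close> equals the number
  strictly below the next larger value, so consecutive terms cancel.\<close>

lemma sum_levels_telescope:
  fixes s :: "'i \<Rightarrow> real" and \<phi> :: "nat \<Rightarrow> real"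
  assumes "finite J"
  shows "(\<Sum>x\<in>s ` J. \<phi> (card {i\<in>J. s i \<le> x}) - \<phi> (card {i\<in>J. s i < x})) = \<phi> (card J) - \<phi> 0"
proof -
  \<comment> \<open>Counting only indices with value in \<open>A\<close> makes the claim inductive:
    a new maximum \<open>b\<close> leaves the terms at smaller values unchanged and adds exactly the
    increment from the old total count to the new one.\<close>
  have "finite A \<Longrightarrow> (\<Sum>x\<in>A. \<phi> (card {i\<in>J. s i \<in> A \<and> s i \<le> x}) - \<phi> (card {i\<in>J. s i \<in> A \<and> s i < x}))
      = \<phi> (card {i\<in>J. s i \<in> A}) - \<phi> 0" for A
  proof (induction A rule: finite_linorder_max_induct)
    case empty
    then show ?case by simp
  next
    case (insert b A)
    have "b \<notin> A" using insert by auto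
    have 1: "{i\<in>J. s i \<in> insert b A \<and> s i \<le> x} = {i\<in>J. s i \<in> A \<and> s i \<le> x}"
      "{i\<in>J. s i \<in> insert b A \<and> s i < x} = {i\<in>J. s i \<in> A \<and> s i < x}" if "x \<in> A" for x
      using insert.hyps(2) that by force+
    have 2: "{i\<in>J. s i \<in> insert b A \<and> s i \<le> b} = {i\<in>J. s i \<in> insert b A}"
      "{i\<in>J. s i \<in> insert b A \<and> s i < b} = {i\<in>J. s i \<in> A}"
      using insert.hyps(2) by force+
    show ?case
      unfolding sum.insert[OF insert.hyps(1) \<open>b \<notin> A\<close>] 2
      using insert.IH by (simp only: 1 cong: sum.cong)
  qed
  from this[of "s ` J"] show ?thesis
    using assms by (simp add: conj_ac cong: conj_cong)
qed

text \<open>Tied indices contribute equal terms, and the divisor is the size of the tie class. Each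
  class therefore contributes one increment of \<open>\<phi>\<close>, and the increments telescope
  over the levels.\<close>

lemma sum_ranks_telescope:
  fixes s :: "'i \<Rightarrow> real" and \<phi> :: "nat \<Rightarrow> real"
  assumes "finite J"
  shows "(\<Sum>j\<in>J. (\<phi> (card {i\<in>J. s i \<le> s j}) - \<phi> (card {i\<in>J. s i < s j})) / card {i\<in>J. s i = s j})
     = \<phi> (card J) - \<phi> 0"
proof -
  define g where "g x = \<phi> (card {i\<in>J. s i \<le> x}) - \<phi> (card {i\<in>J. s i < x})" for x
  have "(\<Sum>j\<in>J. g (s j) / card {i\<in>J. s i = s j})
      = (\<Sum>x\<in>s ` J. \<Sum>j\<in>{i\<in>J. s i = x}. g (s j) / card {i\<in>J. s i = s j})"
    using assms by (intro sum.image_gen)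
  also have "\<dots> = (\<Sum>x\<in>s ` J. g x)"
    using assms by (intro sum.cong) auto
  finally show ?thesis
    using sum_levels_telescope[OF assms] by (simp add: g_def)
qed

lemma prob_space_uniform_unit: "prob_space (uniform_measure lborel {0..1::real})"
  by (intro prob_space_uniform_measure) auto

text \<open>Writing the probability as an increment of \<open>min _ c\<close> from \<open>a\<close>
  to \<open>a + b\<close> prepares the telescoping over ranks.\<close>

lemma measure_uniform_affine_le:
  fixes a b c :: real
  assumes "b > 0"
  shows "measure (uniform_measure lborel {0..1}) {t. a + t * b \<le> c}
     = (min (a + b) c - min a c) / b"
proof -
  \<comment> \<open>For \<open>c < a\<close> the right-hand interval is empty, which is where the
    \<open>max 0\<close> below comes from.\<close>
  have "{0..1} \<inter> {t. a + t * b \<le> c} = {0..min 1 ((c - a) / b)}"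
    using assms by (auto simp: field_simps)
  moreover have "{t. a + t * b \<le> c} \<in> sets lborel"
    by measurable
  ultimately have "measure (uniform_measure lborel {0..1}) {t. a + t * b \<le> c}
      = measure lborel {0..min 1 ((c - a) / b)}"
    by (subst measure_uniform_measure) auto
  also have "\<dots> = max 0 (min 1 ((c - a) / b))"
    by (simp add: max_def)
  also have "\<dots> = (min (a + b) c - min a c) / b"
    using assms by (auto simp: max_def min_def field_simps)
  finally show ?thesis .
qed

text \<open>Scaled by \<open>card J\<close>, the rank of \<open>j\<close> is uniform between the
  number of smaller scores and the number of scores at most \<open>s j\<close>. Telescoping applies
  with \<open>\<phi> k = min k (card J * v)\<close>, and \<open>0 \<le> v \<le> 1\<close> evaluates
  the two end terms.\<close>

lemma sum_prob_smoothed_rank_le: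
  fixes s :: "'i \<Rightarrow> real" and v :: real
  assumes "finite J" "J \<noteq> {}" "0 \<le> v" "v \<le> 1"
  shows "(\<Sum>j\<in>J. measure (uniform_measure lborel {0..1}) {t. smoothed_rank J s j t \<le> v})
     = card J * v"
proof -
  have K: "real (card J) > 0"
    using assms by (simp add: card_gt_0_iff)
  have "measure (uniform_measure lborel {0..1}) {t. smoothed_rank J s j t \<le> v}
     = (min (real (card {i\<in>J. s i \<le> s j})) (card J * v)
         - min (real (card {i\<in>J. s i < s j})) (card J * v)) / card {i\<in>J. s i = s j}"
    if "j \<in> J" for j
  proof -
    have "card {i\<in>J. s i = s j} > 0"
      using assms that by (auto simp: card_gt_0_iff)
    moreover have "card {i\<in>J. s i \<le> s j} = card {i\<in>J. s i < s j} + card {i\<in>J. s i = s j}"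
      using assms by (subst card_Un_disjoint[symmetric]) (auto intro: arg_cong[where f = card])
    moreover have "{t. smoothed_rank J s j t \<le> v}
      = {t. real (card {i\<in>J. s i < s j}) + t * real (card {i\<in>J. s i = s j}) \<le> card J * v}"
      using K by (auto simp: smoothed_rank_def field_simps)
    ultimately show ?thesis
      by (simp add: measure_uniform_affine_le del: measure_uniform_measure)
  qed
  then have "(\<Sum>j\<in>J. measure (uniform_measure lborel {0..1}) {t. smoothed_rank J s j t \<le> v})
     = min (real (card J)) (card J * v) - min (real 0) (card J * v)"
    using sum_ranks_telescope[OF assms(1), of "\<lambda>k. min (real k) (card J * v)" s] by simp
  also have "\<dots> = card J * v"
    using assms K by (auto simp: min_def mult_le_cancel_left1)
  finally show ?thesis .
qed

text \<open>Counts over \<open>J\<close> do not see a relabelling of \<open>J\<close>; only the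
  position being ranked moves.\<close>

lemma smoothed_rank_permute:
  assumes "\<pi> permutes J"
  shows "smoothed_rank J (s \<circ> \<pi>) j t = smoothed_rank J s (\<pi> j) t"
proof -
  have "card {i\<in>J. P (s (\<pi> i))} = card {i\<in>J. P (s i)}" for P
    using assms
    by (intro bij_betw_same_card[of \<pi>] bij_betw_byWitness[where f' = "inv \<pi>"])
       (auto simp: permutes_inverses permutes_in_image permutes_inv_eq permutes_inv)
  from this[of "\<lambda>x. x < s (\<pi> j)"] this[of "\<lambda>x. x = s (\<pi> j)"] show ?thesis
    by (simp add: smoothed_rank_def)
qed

section \<open>Exchangeability and the uniform law of the rank\<close>

lemma (in prob_space) indep_rv_pair_distr:
  assumes "indep_rv M N X N' Y" and [measurable]: "X \<in> measurable M N" "Y \<in> measurable M N'"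
  shows "distr M (N \<Otimes>\<^sub>M N') (\<lambda>\<omega>. (X \<omega>, Y \<omega>)) = distr M N X \<Otimes>\<^sub>M distr M N' Y"
\<comment> \<open>A product of sigma-finite measures is determined by its values on rectangles, and
  there independence is exactly the required factorization.\<close>
proof (rule pair_measure_eqI[symmetric])
  show "sigma_finite_measure (distr M N X)" "sigma_finite_measure (distr M N' Y)"
    by (intro finite_measure.axioms(1) prob_space.finite_measure prob_space_distr; simp)+
  show "sets (distr M N X \<Otimes>\<^sub>M distr M N' Y) = sets (distr M (N \<Otimes>\<^sub>M N') (\<lambda>\<omega>. (X \<omega>, Y \<omega>)))"
    by (simp cong: sets_pair_measure_cong)
next
  fix A B assume "A \<in> sets (distr M N X)" "B \<in> sets (distr M N' Y)"
  then have [measurable]: "A \<in> sets N" "B \<in> sets N'" by simp_all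
  have "prob ((X -` A \<inter> space M) \<inter> (Y -` B \<inter> space M)) = prob (X -` A \<inter> space M) * prob (Y -` B \<inter> space M)"
    using assms(1) unfolding indep_rv_def by (rule indep_setD) auto
  moreover have "(\<lambda>\<omega>. (X \<omega>, Y \<omega>)) -` (A \<times> B) \<inter> space M = (X -` A \<inter> space M) \<inter> (Y -` B \<inter> space M)"
    by auto
  ultimately show "emeasure (distr M N X) A * emeasure (distr M N' Y) B
      = emeasure (distr M (N \<Otimes>\<^sub>M N') (\<lambda>\<omega>. (X \<omega>, Y \<omega>))) (A \<times> B)"
    by (simp add: emeasure_distr emeasure_eq_measure ennreal_mult)
qed

lemma borel_measurable_card_filter [measurable]:
  assumes "finite J" "\<And>i. i \<in> J \<Longrightarrow> Measurable.pred N (P i)"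
  shows "(\<lambda>z. real (card {i\<in>J. P i z})) \<in> borel_measurable N"
proof -
  have "real (card {i\<in>J. P i z}) = (\<Sum>i\<in>J. if P i z then 1 else 0)" for z
    using assms(1) by (simp add: sum.If_cases Int_def)
  moreover have "(\<lambda>z. \<Sum>i\<in>J. if P i z then 1 else 0 :: real) \<in> borel_measurable N"
    using assms(2) by (intro borel_measurable_sum) measurable
  ultimately show ?thesis by simp
qed

text \<open>The coordinates in \<open>I - J\<close> parametrize the score and those in
  \<open>J\<close> are ranked. Permuting \<open>J\<close> alone leaves the score function fixed, so
  all positions in \<open>J\<close> have ranks with the same law. Their distribution functions at
  \<open>v\<close> add up to \<open>card J * v\<close> already for fixed data, after integrating out
  \<open>\<tau>\<close>.\<close>

lemma (in prob_space) smoothed_rank_uniform: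
  fixes X :: "'i \<Rightarrow> 'a \<Rightarrow> 'b" and S :: "('i \<Rightarrow> 'b) \<Rightarrow> 'b \<Rightarrow> real"
  assumes J: "finite J" "J \<subseteq> I" "k \<in> J"
    and X: "\<And>i. i \<in> I \<Longrightarrow> X i \<in> measurable M N"
    and ex: "exchangeable M I N X"
    and \<tau> [measurable]: "\<tau> \<in> borel_measurable M"
    and unif: "distr M borel \<tau> = uniform_measure lborel {0..1}"
    and ind: "indep_rv M (\<Pi>\<^sub>M i\<in>I. N) (\<lambda>\<omega>. \<lambda>i\<in>I. X i \<omega>) borel \<tau>"
    and S: "(\<lambda>(z, w). S z w) \<in> borel_measurable ((\<Pi>\<^sub>M i\<in>I - J. N) \<Otimes>\<^sub>M N)"
    and v: "0 \<le> v" "v \<le> 1"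
  defines "R \<equiv> \<lambda>\<omega>. smoothed_rank J (\<lambda>i. S (\<lambda>i\<in>I - J. X i \<omega>) (X i \<omega>)) k (\<tau> \<omega>)"
  shows "R \<in> borel_measurable M" "prob {\<omega>\<in>space M. R \<omega> \<le> v} = v"
proof -
  let ?U = "uniform_measure lborel {0..1::real}"
  let ?PI = "\<Pi>\<^sub>M i\<in>I. N"
  define W where "W = (\<lambda>\<omega>. \<lambda>i\<in>I. X i \<omega>)"
  define L where "L = distr M ?PI W"
  define s where "s z i = S (restrict z (I - J)) (z i)" for z i
  interpret U: prob_space ?U by (rule prob_space_uniform_unit)
  have W [measurable]: "W \<in> measurable M ?PI"
    unfolding W_def using X by measurable
  interpret L: prob_space L
    unfolding L_def by (rule prob_space_distr) (rule W)
  have s_meas [measurable]: "(\<lambda>z. s z i) \<in> borel_measurable ?PI" if "i \<in> I" for i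
  proof -
    have "(\<lambda>z. (restrict z (I - J), z i)) \<in> measurable ?PI ((\<Pi>\<^sub>M i\<in>I - J. N) \<Otimes>\<^sub>M N)"
      using that by (intro measurable_Pair measurable_restrict_subset measurable_component_singleton) auto
    from measurable_compose[OF this S] show ?thesis
      by (simp add: s_def)
  qed
  have rank_meas: "(\<lambda>(z, t). smoothed_rank J (s z) j t) \<in> borel_measurable (?PI \<Otimes>\<^sub>M borel)"
    if "j \<in> J" for j
  proof -
    have *: "(\<lambda>x. s (fst x) i) \<in> borel_measurable (?PI \<Otimes>\<^sub>M borel)" if "i \<in> J" for i
      by (rule measurable_compose[OF measurable_fst s_meas]) (use that J in auto)
    note [measurable] = *[OF that] *
    show ?thesis
      unfolding smoothed_rank_def case_prod_beta
      using J(1) by measurable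
  qed
  define B where "B j = {x\<in>space (?PI \<Otimes>\<^sub>M borel). smoothed_rank J (s (fst x)) j (snd x) \<le> v}" for j
  have B [measurable]: "B j \<in> sets (?PI \<Otimes>\<^sub>M borel)" if "j \<in> J" for j
    using rank_meas[OF that] unfolding B_def case_prod_beta by measurable
  have R: "R \<omega> = smoothed_rank J (s (W \<omega>)) k (\<tau> \<omega>)" for \<omega>
  proof -
    have "(\<lambda>i\<in>I - J. X i \<omega>) = restrict (W \<omega>) (I - J)"
      by (auto simp: W_def)
    moreover have "s (W \<omega>) i = S (restrict (W \<omega>) (I - J)) (X i \<omega>)" if "i \<in> J" for i
      using that J by (auto simp: s_def W_def)
    ultimately show ?thesis
      using J(3) by (simp add: R_def smoothed_rank_def cong: conj_cong)
  qed
  have WT [measurable]: "(\<lambda>\<omega>. (W \<omega>, \<tau> \<omega>)) \<in> measurable M (?PI \<Otimes>\<^sub>M borel)"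
    by measurable
  show "R \<in> borel_measurable M"
    using measurable_compose[OF WT rank_meas[OF J(3)]] unfolding R by simp
  have sets_L: "sets (L \<Otimes>\<^sub>M ?U) = sets (?PI \<Otimes>\<^sub>M borel)"
    by (intro sets_pair_measure_cong) (simp_all add: L_def)
  have g_meas: "(\<lambda>z. emeasure ?U (Pair z -` B j)) \<in> borel_measurable ?PI" if "j \<in> J" for j
  proof -
    have "sets (?PI \<Otimes>\<^sub>M ?U) = sets (?PI \<Otimes>\<^sub>M borel)"
      by (intro sets_pair_measure_cong) simp_all
    then show ?thesis
      using U.measurable_emeasure_Pair[of "B j" ?PI] B[OF that] by (simp only:)
  qed
  \<comment> \<open>By independence \<open>(W, \<tau>)\<close> has the product law
    \<open>L \<Otimes>\<^sub>M ?U\<close>, so Fubini integrates out \<open>\<tau>\<close> first,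
    section by section.\<close>
  have law: "emeasure M {\<omega>\<in>space M. R \<omega> \<le> v} = (\<integral>\<^sup>+z. emeasure ?U (Pair z -` B k) \<partial>L)"
  proof -
    have "{\<omega>\<in>space M. R \<omega> \<le> v} = (\<lambda>\<omega>. (W \<omega>, \<tau> \<omega>)) -` B k \<inter> space M"
      using measurable_space[OF WT] by (auto simp: R B_def)
    then have "emeasure M {\<omega>\<in>space M. R \<omega> \<le> v}
        = emeasure (distr M (?PI \<Otimes>\<^sub>M borel) (\<lambda>\<omega>. (W \<omega>, \<tau> \<omega>))) (B k)"
      using J by (simp add: emeasure_distr)
    also have "\<dots> = emeasure (L \<Otimes>\<^sub>M ?U) (B k)"
      using indep_rv_pair_distr[OF ind W[unfolded W_def] \<tau>] by (simp add: L_def W_def unif)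
    also have "\<dots> = (\<integral>\<^sup>+z. emeasure ?U (Pair z -` B k) \<partial>L)"
      by (intro U.emeasure_pair_measure_alt) (simp only: sets_L B[OF J(3)])
    finally show ?thesis .
  qed
  \<comment> \<open>Swapping \<open>j\<close> and \<open>k\<close> preserves \<open>L\<close> by
    exchangeability. It fixes every coordinate in \<open>I - J\<close>, hence the first argument of
    \<open>S\<close>, and turns the rank of \<open>k\<close> into the rank of
    \<open>j\<close>.\<close>
  have exch: "(\<integral>\<^sup>+z. emeasure ?U (Pair z -` B j) \<partial>L) = (\<integral>\<^sup>+z. emeasure ?U (Pair z -` B k) \<partial>L)"
    if j: "j \<in> J" for j
  proof -
    define \<pi> where "\<pi> = Transposition.transpose j k"
    have \<pi>: "\<pi> permutes J" "\<pi> permutes I" "\<pi> k = j"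
      using j J by (auto simp: \<pi>_def intro!: permutes_swap_id)
    define h where "h z = (\<lambda>i\<in>I. z (\<pi> i))" for z :: "'i \<Rightarrow> 'b"
    have h [measurable]: "h \<in> measurable ?PI ?PI"
      unfolding h_def using \<pi>(2)
      by (intro measurable_restrict measurable_component_singleton) (simp add: permutes_in_image)
    have "distr L ?PI h = distr M ?PI (\<lambda>\<omega>. \<lambda>i\<in>I. X (\<pi> i) \<omega>)"
      unfolding L_def using \<pi>(2)
      by (subst distr_distr[OF h W]) (auto simp: h_def W_def o_def permutes_in_image intro!: distr_cong)
    also have "\<dots> = L"
      using ex \<pi>(2) unfolding exchangeable_def L_def W_def by blast
    finally have L: "distr L ?PI h = L" .
    have sh: "s (h z) i = s z (\<pi> i)" if "i \<in> J" for z i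
    proof -
      have "restrict (h z) (I - J) = restrict z (I - J)"
        using \<pi>(1) by (auto simp: h_def permutes_not_in)
      then show ?thesis
        using that J by (auto simp: s_def h_def)
    qed
    have "smoothed_rank J (s (h z)) k t = smoothed_rank J (s z) j t" for z t
      using smoothed_rank_permute[OF \<pi>(1), of "s z" k t] \<pi>(3) J(3)
      by (simp add: smoothed_rank_def sh cong: conj_cong)
    then have "emeasure ?U (Pair (h z) -` B k) = emeasure ?U (Pair z -` B j)" if "z \<in> space ?PI" for z
      using that measurable_space[OF h that] by (simp add: B_def space_pair_measure vimage_def)
    then have "(\<integral>\<^sup>+z. emeasure ?U (Pair z -` B j) \<partial>L) = (\<integral>\<^sup>+z. emeasure ?U (Pair (h z) -` B k) \<partial>L)"
      by (intro nn_integral_cong) (simp add: L_def)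
    also have "\<dots> = (\<integral>\<^sup>+z. emeasure ?U (Pair z -` B k) \<partial>distr L ?PI h)"
      using g_meas[OF J(3)] h by (subst nn_integral_distr) (auto simp: L_def)
    finally show ?thesis
      by (simp add: L)
  qed
  \<comment> \<open>The probability is counted once per position. Moving the sum inside the integral
    leaves an integrand that is constant in \<open>z\<close>.\<close>
  have "of_nat (card J) * emeasure M {\<omega>\<in>space M. R \<omega> \<le> v}
      = (\<Sum>j\<in>J. \<integral>\<^sup>+z. emeasure ?U (Pair z -` B j) \<partial>L)"
    using exch by (simp add: law)
  also have "\<dots> = (\<integral>\<^sup>+z. (\<Sum>j\<in>J. emeasure ?U (Pair z -` B j)) \<partial>L)"
    using g_meas by (intro nn_integral_sum[symmetric]) (simp add: L_def)
  also have "\<dots> = (\<integral>\<^sup>+z. ennreal (card J * v) \<partial>L)"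
  proof (intro nn_integral_cong)
    fix z assume "z \<in> space L"
    have "J \<noteq> {}" using J(3) by auto
    from \<open>z \<in> space L\<close> have "Pair z -` B j = {t. smoothed_rank J (s z) j t \<le> v}" for j
      by (auto simp: B_def L_def space_pair_measure)
    then show "(\<Sum>j\<in>J. emeasure ?U (Pair z -` B j)) = ennreal (card J * v)"
      using sum_prob_smoothed_rank_le[OF J(1) _ v, of "s z"] \<open>J \<noteq> {}\<close>
      by (simp add: U.emeasure_eq_measure sum_ennreal del: measure_uniform_measure)
  qed
  also have "\<dots> = ennreal (card J * v)"
    by (simp add: L.emeasure_space_1)
  finally have "ennreal (card J * prob {\<omega>\<in>space M. R \<omega> \<le> v}) = ennreal (card J * v)"
    by (simp add: emeasure_eq_measure ennreal_mult ennreal_of_nat_eq_real_of_nat)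
  moreover have "card J > 0"
    using J by (auto simp: card_gt_0_iff)
  ultimately show "prob {\<omega>\<in>space M. R \<omega> \<le> v} = v"
    using v by (simp add: ennreal_inj)
qed

section \<open>The transducer and the predictive distributions as counts\<close>

lemma split_transducer_eq_smoothed_rank:
  assumes "m < n"
  shows "split_transducer m n E z (z (n + 1)) t =
    smoothed_rank {m+1..n+1} (\<lambda>i. E (restrict z {1..m}) (z i)) (n + 1) t"
proof -
  let ?s = "\<lambda>i. E (restrict z {1..m}) (z i)"
  have card: "card {i\<in>{1..n - m}. P (?s (m + i))} = card {i\<in>{m+1..n}. P (?s i)}" for P
    by (intro bij_betw_same_card[of "\<lambda>i. m + i"] bij_betw_byWitness[where f' = "\<lambda>i. i - m"]) auto
  have "{i\<in>{m+1..n+1}. ?s i < ?s (n + 1)} = {i\<in>{m+1..n}. ?s i < ?s (n + 1)}"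
    by (auto simp: le_Suc_eq)
  \<comment> \<open>The new observation ties with itself. This accounts for the separate summand
    \<open>t\<close> in the numerator of the transducer.\<close>
  moreover have "{i\<in>{m+1..n+1}. ?s i = ?s (n + 1)} = insert (n + 1) {i\<in>{m+1..n}. ?s i = ?s (n + 1)}"
    using assms by (auto simp: le_Suc_eq)
  moreover have "card {m+1..n+1} = n - m + 1"
    using assms by simp
  ultimately show ?thesis
    unfolding split_transducer_def smoothed_rank_def Let_def
      card[of "\<lambda>x. x < ?s (n + 1)"] card[of "\<lambda>x. x = ?s (n + 1)"]
    by (simp add: algebra_simps del: card_atLeastAtMost)
qed

text \<open>The first summand \<open>t\<close> is the mass at minus infinity, which lies below every
  real \<open>y\<close>; the mass at plus infinity is never counted.\<close>

lemma cpd_eq_card: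
  assumes "0 \<le> t"
  shows "cpd m n E z (x, y) t =
    (t + real (card {i\<in>{1..n - m}. conformal_atom m E z x i < y})
       + t * real (card {i\<in>{1..n - m}. conformal_atom m E z x i = y})) / real (n - m + 1)"
  using measure_cpd_measure[of "{..<ereal y}" True t m n E z x]
    measure_cpd_measure[of "{ereal y}" False t m n E z x] assms
  by (simp add: cpd_def add_divide_distrib)

lemma sorted_atom_mono:
  assumes "1 \<le> i" "i \<le> j" "j \<le> n - m"
  shows "sorted_atom m n E z x i \<le> sorted_atom m n E z x j"
  unfolding sorted_atom_def using assms by (intro sorted_nth_mono) auto

text \<open>The correction moves mass \<open>t / K\<close> from minus infinity to the smallest atom
  and \<open>(1 - t) / K\<close> from plus infinity to the largest, where
  \<open>K = n - m + 1\<close>. Off the atoms the point masses at \<open>y\<close> vanish, and only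
  these two displacements can change the mass below \<open>y\<close>.\<close>

lemma tail_corrected_close_to_cpd:
  assumes "n - m \<ge> 2" "0 \<le> t" "t \<le> 1" "y \<notin> conformal_atom m E z x ` {1..n - m}"
  shows "\<bar>tail_corrected_cpd m n E z (x, y) t - cpd m n E z (x, y) t\<bar> \<le> 1 / real (n - m + 1)"
proof -
  let ?N = "n - m" and ?K = "real (n - m + 1)"
  let ?c = "sorted_atom m n E z x"
  let ?C = "conformal_atom m E z x"
  define k where "k = real (card {i\<in>{1..?N}. ?C i < y})"
  define p q where "p = (if ?c 1 < y then 1 else 0 :: real)" and "q = (if ?c ?N < y then 1 else 0 :: real)"
  \<comment> \<open>Since \<open>n - m \<ge> 2\<close>, the first and last indices differ; the
    middle range is empty when \<open>n - m = 2\<close>.\<close>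
  have split: "{1..?N} = insert 1 (insert ?N {2..?N - 1})"
    using assms(1) by auto
  have sum_split: "sum f {1..?N} = f 1 + (\<Sum>i = 2..?N - 1. f i) + f ?N" for f :: "nat \<Rightarrow> real"
    using assms(1) unfolding split by (subst sum.insert; simp)+
  \<comment> \<open>The end weights \<open>1 + t\<close> and \<open>2 - t\<close> split into the
    ordinary weight 1 and the displaced tails \<open>t\<close> and \<open>1 - t\<close>. The
    ordinary part is then a sum over all atoms, in which sorting is irrelevant.\<close>
  have regroup: "(1 + t) / K * a + 1 / K * S + (2 - t) / K * b = (t * a + (a + S + b) + (1 - t) * b) / K"
    for K a b S :: real
    by (simp add: add_divide_distrib diff_divide_distrib algebra_simps)
  have ind: "indicator A u = ennreal (indicat_real A u)" for A :: "real set" and u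
    by (simp add: indicator_def)
  have meas: "measure (tail_corrected_measure m n E z x t) A
      = (t * indicat_real A (?c 1) + (\<Sum>i = 1..?N. indicat_real A (?C i))
          + (1 - t) * indicat_real A (?c ?N)) / ?K"
    if "A \<in> sets borel" for A
  proof -
    have "emeasure (tail_corrected_measure m n E z x t) A
      = ennreal ((1 + t) / ?K * indicat_real A (?c 1) + (\<Sum>i = 2..?N - 1. 1 / ?K * indicat_real A (?c i))
         + (2 - t) / ?K * indicat_real A (?c ?N))"
      unfolding emeasure_tail_corrected_measure[OF that] ind
      using assms by (simp add: sum_nonneg flip: ennreal_mult ennreal_plus)
    also have "(1 + t) / ?K * indicat_real A (?c 1) + (\<Sum>i = 2..?N - 1. 1 / ?K * indicat_real A (?c i))
         + (2 - t) / ?K * indicat_real A (?c ?N)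
       = (t * indicat_real A (?c 1) + (\<Sum>i = 1..?N. indicat_real A (?c i))
          + (1 - t) * indicat_real A (?c ?N)) / ?K"
      unfolding sum_split sum_distrib_left[symmetric] regroup ..
    finally have "emeasure (tail_corrected_measure m n E z x t) A = ennreal \<dots>" .
    then show ?thesis
      using assms unfolding sum_sorted_atom by (simp add: measure_def sum_nonneg)
  qed
  have "?c i \<noteq> y" if "1 \<le> i" "i \<le> ?N" for i
  proof -
    have "?c i \<in> set (sort (map ?C [1..<?N + 1]))"
      unfolding sorted_atom_def using that by (intro nth_mem) simp
    then show ?thesis
      using assms(4) by auto
  qed
  then have ne: "?c 1 \<noteq> y" "?c ?N \<noteq> y"
    using assms(1) by auto
  have "(\<Sum>i = 1..?N. indicat_real {y} (?C i)) = 0"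
    using assms(4) by (intro sum.neutral) (auto simp: indicator_def)
  then have 1: "measure (tail_corrected_measure m n E z x t) {y} = 0"
    using ne by (simp add: meas)
  have "(\<Sum>i = 1..?N. indicat_real {..<y} (?C i)) = k"
    by (simp add: k_def indicator_def sum.If_cases Int_def)
  then have 2: "measure (tail_corrected_measure m n E z x t) {..<y} = (t * p + k + (1 - t) * q) / ?K"
    by (simp add: meas p_def q_def indicator_def)
  have "card {i\<in>{1..?N}. ?C i = y} = 0"
    using assms(4) by auto
  then have 3: "cpd m n E z (x, y) t = (t + k) / ?K"
    using assms by (simp add: cpd_eq_card k_def)
  \<comment> \<open>The difference of numerators is \<open>- t\<close> below all atoms,
    \<open>1 - t\<close> above all of them, and \<open>0\<close> between the extreme ones.\<close>
  have "?c 1 \<le> ?c ?N"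
    using assms(1) by (intro sorted_atom_mono) auto
  then have "\<bar>t * p + k + (1 - t) * q - (t + k)\<bar> \<le> 1"
    using assms(2,3) by (auto simp: p_def q_def)
  then show ?thesis
    unfolding tail_corrected_cpd_def 3 by (simp add: 1 2 divide_right_mono flip: diff_divide_distrib)
qed

section \<open>Passing from rational non-atoms to every point\<close>

lemma isCont_abs_diff_le:
  fixes h :: "real \<Rightarrow> real"
  assumes "isCont h y" and "\<And>r. r > 0 \<Longrightarrow> \<exists>q. \<bar>q - y\<bar> < r \<and> \<bar>h q - c\<bar> \<le> \<delta>"
  shows "\<bar>h y - c\<bar> \<le> \<delta>"
proof (rule ccontr)
  assume "\<not> \<bar>h y - c\<bar> \<le> \<delta>"
  then have "\<bar>h y - c\<bar> - \<delta> > 0" by simp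
  then obtain r where r: "r > 0" "\<And>q. \<bar>q - y\<bar> < r \<Longrightarrow> \<bar>h q - h y\<bar> < \<bar>h y - c\<bar> - \<delta>"
    using assms(1) unfolding continuous_at_eps_delta dist_real_def by metis
  then show False
    using assms(2)[OF r(1)] by force
qed

text \<open>The step function is constant just to the left and just to the right of
  \<open>y\<close>, so continuity of \<open>h\<close> carries the bound to both one-sided values.
  The randomized value at \<open>y\<close> is their convex combination, even if \<open>y\<close> is
  an atom. Only rational \<open>q\<close> are used because closeness will be available almost surely
  on countable sets only.\<close>

lemma continuous_close_to_step:
  fixes h :: "real \<Rightarrow> real" and C :: "'i \<Rightarrow> real"
  assumes "finite J" "isCont h y" "0 \<le> t" "t \<le> 1"
    and close: "\<And>q. q \<in> \<rat> \<Longrightarrow> q \<notin> C ` J \<Longrightarrow> \<bar>h q - (a + b * real (card {i\<in>J. C i < q}))\<bar> \<le> \<delta>"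
  shows "\<bar>h y - (a + b * (real (card {i\<in>J. C i < y}) + t * real (card {i\<in>J. C i = y})))\<bar> \<le> \<delta>"
proof -
  \<comment> \<open>Points within \<open>d\<close> of \<open>y\<close>, other than \<open>y\<close>
    itself, are not atoms, and no atom lies strictly between them and \<open>y\<close>.\<close>
  obtain d where d: "d > 0" "\<And>x. x \<in> C ` J \<Longrightarrow> x \<noteq> y \<Longrightarrow> d \<le> dist y x"
    using finite_set_avoid[of "C ` J" y] assms(1) by auto
  have avoid: "d \<le> \<bar>y - C i\<bar>" if "i \<in> J" "C i \<noteq> y" for i
    using d(2)[of "C i"] that by (auto simp: dist_real_def)
  have left: "\<bar>h y - (a + b * real (card {i\<in>J. C i < y}))\<bar> \<le> \<delta>"
  proof (rule isCont_abs_diff_le[OF assms(2)])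
    fix r :: real assume "r > 0"
    then obtain q where q: "q \<in> \<rat>" "y - min r d < q" "q < y"
      using Rats_dense_in_real[of "y - min r d" y] d(1) by auto
    have lt: "C i < q \<longleftrightarrow> C i < y" and ne: "C i \<noteq> q" if "i \<in> J" for i
      using avoid[OF that] q by (cases "C i = y"; force)+
    have "{i\<in>J. C i < q} = {i\<in>J. C i < y}" "q \<notin> C ` J"
      using lt ne by auto
    then show "\<exists>q. \<bar>q - y\<bar> < r \<and> \<bar>h q - (a + b * real (card {i\<in>J. C i < y}))\<bar> \<le> \<delta>"
      using close[OF q(1)] q by (intro exI[of _ q]) auto
  qed
  have right: "\<bar>h y - (a + b * real (card {i\<in>J. C i \<le> y}))\<bar> \<le> \<delta>"
  proof (rule isCont_abs_diff_le[OF assms(2)])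
    fix r :: real assume "r > 0"
    then obtain q where q: "q \<in> \<rat>" "y < q" "q < y + min r d"
      using Rats_dense_in_real[of y "y + min r d"] d(1) by auto
    have lt: "C i < q \<longleftrightarrow> C i \<le> y" and ne: "C i \<noteq> q" if "i \<in> J" for i
      using avoid[OF that] q by (cases "C i = y"; force)+
    have "{i\<in>J. C i < q} = {i\<in>J. C i \<le> y}" "q \<notin> C ` J"
      using lt ne by auto
    then show "\<exists>q. \<bar>q - y\<bar> < r \<and> \<bar>h q - (a + b * real (card {i\<in>J. C i \<le> y}))\<bar> \<le> \<delta>"
      using close[OF q(1)] q by (intro exI[of _ q]) auto
  qed
  define k l where "k = real (card {i\<in>J. C i < y})" and "l = real (card {i\<in>J. C i = y})"
  have "card {i\<in>J. C i \<le> y} = card {i\<in>J. C i < y} + card {i\<in>J. C i = y}"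
    using assms(1) by (subst card_Un_disjoint[symmetric]) (auto intro: arg_cong[where f = card])
  then have kl: "real (card {i\<in>J. C i \<le> y}) = k + l"
    by (simp add: k_def l_def)
  have "h y - (a + b * (k + t * l)) = (1 - t) * (h y - (a + b * k)) + t * (h y - (a + b * (k + l)))"
    by (simp add: algebra_simps)
  also have "\<bar>\<dots>\<bar> \<le> (1 - t) * \<delta> + t * \<delta>"
    using left right assms(3,4) unfolding kl k_def[symmetric]
    by (intro order_trans[OF abs_triangle_ineq] add_mono) (auto simp: abs_mult intro!: mult_left_mono)
  finally show ?thesis
    by (simp add: k_def l_def algebra_simps)
qed

section \<open>From almost sure closeness to distribution functions\<close>

lemma (in prob_space) cdf_close_to_uniform:
  assumes [measurable]: "random_variable borel X" "random_variable borel V"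
    and close: "AE \<omega> in M. \<bar>X \<omega> - V \<omega>\<bar> \<le> \<delta>"
    and unif: "\<And>v. 0 \<le> v \<Longrightarrow> v \<le> 1 \<Longrightarrow> prob {\<omega>\<in>space M. V \<omega> \<le> v} = v"
    and "0 \<le> \<delta>" "0 \<le> u" "u \<le> 1"
  shows "\<bar>prob {\<omega>\<in>space M. X \<omega> \<le> u} - u\<bar> \<le> \<delta>"
proof -
  have "prob {\<omega>\<in>space M. X \<omega> \<le> u} \<le> u + \<delta>"
  \<comment> \<open>Almost surely \<open>X \<le> u\<close> forces
    \<open>V \<le> u + \<delta>\<close>. Beyond 1 the uniform law says nothing, but a probability is
    at most 1 anyway; the lower bound is symmetric.\<close>
  proof (cases "u + \<delta> \<le> 1")
    case True
    have "prob {\<omega>\<in>space M. X \<omega> \<le> u} \<le> prob {\<omega>\<in>space M. V \<omega> \<le> u + \<delta>}"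
      by (rule finite_measure_mono_AE) (use close in auto)
    then show ?thesis using unif[of "u + \<delta>"] True assms by simp
  next
    case False
    then show ?thesis using prob_le_1[of "{\<omega>\<in>space M. X \<omega> \<le> u}"] by linarith
  qed
  moreover have "u - \<delta> \<le> prob {\<omega>\<in>space M. X \<omega> \<le> u}"
  proof (cases "0 \<le> u - \<delta>")
    case True
    have "prob {\<omega>\<in>space M. V \<omega> \<le> u - \<delta>} \<le> prob {\<omega>\<in>space M. X \<omega> \<le> u}"
      by (rule finite_measure_mono_AE) (use close in auto)
    then show ?thesis using unif[of "u - \<delta>"] True assms by simp
  next
    case False
    then show ?thesis using measure_nonneg[of M "{\<omega>\<in>space M. X \<omega> \<le> u}"] by linarith
  qed
  ultimately show ?thesis by linarith
qed

theorem theorem5: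
  fixes M :: "'a measure"
    and Z :: "nat \<Rightarrow> 'a \<Rightarrow> (real ^ 'p::finite) \<times> real"
    and \<tau> :: "'a \<Rightarrow> real"
    and E :: "(nat \<Rightarrow> (real ^ 'p) \<times> real) \<Rightarrow> (real ^ 'p) \<times> real \<Rightarrow> real"
    and Qhat :: "(nat \<Rightarrow> (real ^ 'p) \<times> real) \<Rightarrow> (real ^ 'p) \<times> real \<Rightarrow> real \<Rightarrow> real"
    and m n :: nat
    and \<epsilon> :: real
  assumes "prob_space M"
    and "m < n" and "n - m \<ge> 2"
    and "\<And>i. i \<in> {1..n + 1} \<Longrightarrow> Z i \<in> borel_measurable M"
    and "exchangeable M {1..n + 1} borel Z"
    and "\<tau> \<in> borel_measurable M"
    and "distr M borel \<tau> = uniform_measure lborel {0..1}"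
    and "indep_rv M (\<Pi>\<^sub>M i\<in>{1..n + 1}. borel) (\<lambda>\<omega>. \<lambda>i\<in>{1..n + 1}. Z i \<omega>) borel \<tau>"
    and "split_conformity_measure m E"
    and "monotonic m E" and "balanced m E" and "coercive m E"
    and "AE \<omega> in M. conformal_atoms_exist m n E (\<lambda>i\<in>{1..n}. Z i \<omega>) (fst (Z (n + 1) \<omega>))"
    and "AE \<omega> in M. inj_on (conformal_atom m E (\<lambda>i\<in>{1..n}. Z i \<omega>) (fst (Z (n + 1) \<omega>))) {1..n - m}"
    and "(\<lambda>(z, w, t). Qhat z w t) \<in> borel_measurable ((\<Pi>\<^sub>M i\<in>{1..n}. borel) \<Otimes>\<^sub>M borel \<Otimes>\<^sub>M borel)"
    and "\<And>\<omega>. \<omega> \<in> space M \<Longrightarrow>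
           continuous_on UNIV (\<lambda>y. Qhat (\<lambda>i\<in>{1..n}. Z i \<omega>) (fst (Z (n + 1) \<omega>), y) (\<tau> \<omega>))"
    and "\<epsilon> > 0"
    and "\<And>y. AE \<omega> in M.
           \<bar>Qhat (\<lambda>i\<in>{1..n}. Z i \<omega>) (fst (Z (n + 1) \<omega>), y) (\<tau> \<omega>)
            - tail_corrected_cpd m n E (\<lambda>i\<in>{1..n}. Z i \<omega>) (fst (Z (n + 1) \<omega>), y) (\<tau> \<omega>)\<bar> \<le> \<epsilon>"
  shows "(SUP u\<in>{0..1}.
            \<bar>measure M {\<omega>\<in>space M. Qhat (\<lambda>i\<in>{1..n}. Z i \<omega>) (Z (n + 1) \<omega>) (\<tau> \<omega>) \<le> u} - u\<bar>)
         \<le> \<epsilon> + 1 / real (n - m + 1)"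
proof -
  interpret prob_space M by fact
  define \<zeta> where "\<zeta> \<omega> = (\<lambda>i\<in>{1..n}. Z i \<omega>)" for \<omega>
  define V where "V \<omega> = split_transducer m n E (\<zeta> \<omega>) (Z (n + 1) \<omega>) (\<tau> \<omega>)" for \<omega>
  define \<delta> where "\<delta> = \<epsilon> + 1 / real (n - m + 1)"
  have train: "{1..n + 1} - {m + 1..n + 1} = {1..m}"
    using assms(2) by auto
  have V: "V \<omega> = smoothed_rank {m + 1..n + 1}
      (\<lambda>i. E (\<lambda>i\<in>{1..n + 1} - {m + 1..n + 1}. Z i \<omega>) (Z i \<omega>)) (n + 1) (\<tau> \<omega>)"
    for \<omega>
  proof -
    \<comment> \<open>The transducer reads its data sequence only at the indices up to
      \<open>n\<close>, so the truncated sequence \<open>\<zeta>\<close> may be replaced by the full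
      one that the rank lemma ranges over.\<close>
    have "restrict (\<zeta> \<omega>) {1..m} = restrict (\<lambda>i. Z i \<omega>) {1..m}"
      using assms(2) by (auto simp: \<zeta>_def)
    moreover have "\<zeta> \<omega> (m + i) = Z (m + i) \<omega>" if "i \<in> {1..n - m}" for i
      using that by (auto simp: \<zeta>_def)
    ultimately have "V \<omega> = split_transducer m n E (\<lambda>i. Z i \<omega>) (Z (n + 1) \<omega>) (\<tau> \<omega>)"
      by (simp add: V_def split_transducer_def cong: conj_cong)
    also have "\<dots> = smoothed_rank {m + 1..n + 1} (\<lambda>i. E (\<lambda>i\<in>{1..m}. Z i \<omega>) (Z i \<omega>)) (n + 1) (\<tau> \<omega>)"
      by (rule split_transducer_eq_smoothed_rank[OF assms(2)])
    finally show ?thesis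
      by (simp only: train)
  qed
  note uniform = smoothed_rank_uniform[where I = "{1..n + 1}" and J = "{m + 1..n + 1}" and k = "n + 1"
      and X = Z and N = borel and S = E and \<tau> = \<tau>, folded V, unfolded train]
  have E: "(\<lambda>(z, w). E z w) \<in> borel_measurable ((\<Pi>\<^sub>M i\<in>{1..m}. borel) \<Otimes>\<^sub>M borel)"
    using assms(9) by (simp only: split_conformity_measure_def)
  have rank: "prob {\<omega>\<in>space M. V \<omega> \<le> v} = v" if "0 \<le> v" "v \<le> 1" for v
    by (rule uniform(2)[OF _ _ _ assms(4-8) E that]) (use assms(2) in auto)
  have V_meas: "V \<in> borel_measurable M"
    \<comment> \<open>The level 0 is an arbitrary admissible choice; measurability does not involve
      it.\<close>
    using uniform(1)[OF _ _ _ assms(4-8) E, of 0] assms(2) by simp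
  have "AE t in distr M borel \<tau>. t \<in> {0..1}"
    unfolding assms(7) by (rule AE_uniform_measureI) auto
  then have \<tau>: "AE \<omega> in M. \<tau> \<omega> \<in> {0..1}"
    by (subst (asm) AE_distr_iff) (use assms(6) in auto)
  \<comment> \<open>The exceptional null set of the approximation hypothesis depends on
    \<open>y\<close>; countability of the rationals gives a single one. This is needed because
    \<open>y\<close> will be the random point \<open>snd (Z (n + 1) \<omega>)\<close>.\<close>
  have rat: "AE \<omega> in M. \<forall>q\<in>\<rat>. \<bar>Qhat (\<zeta> \<omega>) (fst (Z (n + 1) \<omega>), q) (\<tau> \<omega>)
            - tail_corrected_cpd m n E (\<zeta> \<omega>) (fst (Z (n + 1) \<omega>), q) (\<tau> \<omega>)\<bar> \<le> \<epsilon>"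
    using assms(18) countable_rat by (subst AE_ball_countable) (auto simp: \<zeta>_def)
  have close: "AE \<omega> in M. \<bar>Qhat (\<zeta> \<omega>) (Z (n + 1) \<omega>) (\<tau> \<omega>) - V \<omega>\<bar> \<le> \<delta>"
    using rat \<tau> assms(13)[folded \<zeta>_def] AE_space
  proof eventually_elim
    case (elim \<omega>)
    let ?K = "real (n - m + 1)" and ?J = "{1..n - m}"
    define x y where "x = fst (Z (n + 1) \<omega>)" and "y = snd (Z (n + 1) \<omega>)"
    define t C h where "t = \<tau> \<omega>" and "C = conformal_atom m E (\<zeta> \<omega>) x"
      and "h = (\<lambda>y. Qhat (\<zeta> \<omega>) (x, y) (\<tau> \<omega>))"
    have t: "0 \<le> t" "t \<le> 1" using elim by (auto simp: t_def)
    have "isCont h y"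
      using assms(16)[OF elim(4)] by (simp add: h_def x_def \<zeta>_def continuous_on_eq_continuous_at)
    \<comment> \<open>Off the atoms \<open>cpd\<close> is affine in the count of atoms below
      \<open>q\<close>, with intercept \<open>t / ?K\<close> and slope \<open>1 / ?K\<close>. The
      triangle inequality through the tail-corrected distribution yields
      \<open>\<epsilon> + 1 / ?K\<close>.\<close>
    moreover have "\<bar>h q - (t / ?K + 1 / ?K * real (card {i\<in>?J. C i < q}))\<bar> \<le> \<delta>"
      if q: "q \<in> \<rat>" "q \<notin> C ` ?J" for q
    proof -
      have "card {i\<in>?J. C i = q} = 0"
        using q by auto
      then have "cpd m n E (\<zeta> \<omega>) (x, q) t = t / ?K + 1 / ?K * real (card {i\<in>?J. C i < q})"
        unfolding cpd_eq_card[OF t(1)] C_def[symmetric] by (simp add: add_divide_distrib)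
      moreover have "\<bar>h q - tail_corrected_cpd m n E (\<zeta> \<omega>) (x, q) t\<bar> \<le> \<epsilon>"
        using elim(1) q by (simp add: h_def t_def x_def)
      moreover have "\<bar>tail_corrected_cpd m n E (\<zeta> \<omega>) (x, q) t - cpd m n E (\<zeta> \<omega>) (x, q) t\<bar> \<le> 1 / ?K"
        using tail_corrected_close_to_cpd[OF assms(3) t] q by (simp add: C_def)
      ultimately show ?thesis
        unfolding \<delta>_def by linarith
    qed
    ultimately have "\<bar>h y - (t / ?K + 1 / ?K *
        (real (card {i\<in>?J. C i < y}) + t * real (card {i\<in>?J. C i = y})))\<bar> \<le> \<delta>"
      using t by (intro continuous_close_to_step) auto
    also have "t / ?K + 1 / ?K * (real (card {i\<in>?J. C i < y}) + t * real (card {i\<in>?J. C i = y}))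
      = cpd m n E (\<zeta> \<omega>) (x, y) t"
      unfolding cpd_eq_card[OF t(1)] C_def[symmetric] by (simp add: add_divide_distrib)
    also have "\<dots> = V \<omega>"
      using cpd_eq_split_transducer[OF assms(10) elim(3) t(1), of y]
      by (simp add: V_def x_def y_def t_def)
    finally show ?case
      by (simp add: h_def x_def y_def)
  qed
  have "\<zeta> \<in> measurable M (\<Pi>\<^sub>M i\<in>{1..n}. borel)"
    unfolding \<zeta>_def[abs_def] using assms(4) by (intro measurable_restrict) auto
  then have "(\<lambda>\<omega>. (\<zeta> \<omega>, Z (n + 1) \<omega>, \<tau> \<omega>)) \<in> measurable M ((\<Pi>\<^sub>M i\<in>{1..n}. borel) \<Otimes>\<^sub>M borel \<Otimes>\<^sub>M borel)"
    using assms(4)[of "n + 1"] assms(6) by (intro measurable_Pair) auto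
  from measurable_compose[OF this assms(15)]
  have "(\<lambda>\<omega>. Qhat (\<zeta> \<omega>) (Z (n + 1) \<omega>) (\<tau> \<omega>)) \<in> borel_measurable M"
    by simp
  note cdf = cdf_close_to_uniform[OF this V_meas close rank]
  show ?thesis
    unfolding \<zeta>_def[symmetric] \<delta>_def[symmetric]
    using assms(17) by (intro cSUP_least cdf) (auto simp: \<delta>_def)
qed

end
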